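(* Let $f:\mathbb{R}^n\to\mathbb{R}$ be locally Lipschitz with a strict first-order model $\phi$, let $x\in\mathbb{R}^n$ be a serious iterate and $Q$ a symmetric matrix. Consider the inner loop of the non-smooth trust-region algorithm at $x$ with the fall-back modification (both described in the context). Suppose the inner loop turns infinitely. Suppose $Q\succ0$ and that the aggregation rule is used in Step 6 to limit the number of affine planes forming $\phi_k$ to any pre-defined fixed number $N\ge3$. Suppose we fall back on $y^k$ as trial step whenever $z^k$ fails in Step 5 with $\widetilde\rho_k<\widetilde\gamma$ in Step 7. Then $0\in\partial f(x)$.
   Context: $\partial f$ denotes the Clarke subdifferential; $\partial_1\phi(y,x)$ is the convex subdifferential of $\phi(\cdot,x)$ at $y$. Strict first-order model: a function $\phi:\mathbb{R}^n\times\mathbb{R}^n\to\mathbb{R}$ such that ($M_1$) $\phi(\cdot,x)$ is convex, $\phi(x,x)=f(x)$, and $\partial_1\phi(x,x)\subset\partial f(x)$ for every $x$; ($\widehat M_2$) if $x_k\to x$ and $y_k\to x$, then there exist $\epsilon_k\to0^+$ with $f(y_k)\le\phi(y_k,x_k)+\epsilon_k\|y_k-x_k\|$; ($M_3$) if $x_k\to x$, $y_k\to y$, then $\limsup_{k\to\infty}\phi(y_k,x_k)\le\phi(y,x)$. Cutting planes: for a trial step $z$ and a subgradient $g\in\partial_1\phi(z,x)$, the affine function $m_z(\cdot,x)=\phi(z,x)+g^\top(\cdot-z)$ is a cutting plane at serious iterate $x$ and trial step $z$. If $z=x$ it is called an exactness plane. Inner loop at $x$. Constants: $0<\gamma<\widetilde\gamma<1$,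 $0<\theta\ll1$, $\theta<1$, $M\ge1$; a fixed norm $\|\cdot\|$ on $\mathbb{R}^n$ (trust-region norm); initial radius $R_1>0$. At each counter $k\ge1$ there is a first-order working model $\phi_k(\cdot,x)$, which is a maximum of finitely many affine minorants of $\phi(\cdot,x)$ (so $\phi_k(\cdot,x)\le\phi(\cdot,x)$), always including at least one exactness plane at $x$; the second-order working model is $\Phi_k(\cdot,x)=\phi_k(\cdot,x)+\frac12(\cdot-x)^\top Q(\cdot-x)$. At counter $k$: (Step 4) $y^k$ is a solution of the tangent program: minimize $\Phi_k(y,x)$ subject to $\|y-x\|\le R_k$. The trial step $z^k$ is any point with $\|z^k-x\|\le M\|y^k-x\|$ and $f(x)-\Phi_k(z^k,x)\ge\theta\,(f(x)-\Phi_k(y^k,x))$ (the choice $z^k=y^k$ is always allowed). (Step 5) If $\rho_k=\dfrac{f(x)-f(z^k)}{f(x)-\Phi_k(z^k,x)}\ge\gamma$, then $z^k$ is accepted as the new serious iterate and the inner loop ends. Otherwise (null step) continue. (Step 6) A cutting plane at $x$ and $z^k$ is included in the new working model $\phi_{k+1}(\cdot,x)$; older planes may be removed, provided an exactness plane at $x$ remains. (Step 7) With $\widetilde\rho_k=\dfrac{f(x)-\phi_{k+1}(z^k,x)}{f(x)-\Phi_k(z^k,x)}$, put $R_{k+1}=R_k$ if $\widetilde\rho_k<\widetilde\gamma$ and $R_{k+1}=\frac12R_k$ if $\widetilde\rho_k\ge\widetilde\gamma$. Increase $k$ and return to Step 4. Fall-back modification: at counter $k$, first try $z^k$. If $z^k$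 is not accepted in Step 5, evaluate Step 7 for $z^k$. If $\widetilde\rho_k\ge\widetilde\gamma$, the radius is halved and the loop continues as usual. If $\widetilde\rho_k<\widetilde\gamma$ (no reduction of $R_k$), then $z^k$ is discarded and $y^k$ is used as trial step instead: the acceptance test of Step 5 is performed with $y^k$ in place of $z^k$; if $y^k$ is accepted the inner loop ends; if not, Steps 6 and 7 are carried out with $y^k$ in place of $z^k$, using the aggregation rule in Step 6. "The inner loop turns infinitely" means that no trial step (neither a $z^k$ nor a fall-back $y^k$) is ever accepted. Aggregation: by the optimality condition for the tangent program there is $g_k^*\in\partial_1\phi_k(y^k,x)$ (the aggregate subgradient; $\partial_1$ here is the convex subdifferential of $\phi_k(\cdot,x)$) with $g_k^*+Q(y^k-x)+v_k=0$, where $v_k$ lies in the normal cone to the ball $B(x,R_k)=\{y:\|y-x\|\le R_k\}$ at $y^k$. The aggregate plane is $m_k^*(\cdot,x)=\phi_k(y^k,x)+g_k^{*\top}(\cdot-y^k)$. The aggregation rule: in Step 6 the new working model $\phi_{k+1}(\cdot,x)$ contains at least an exactness plane at $x$, the latest cutting plane (at the last unsuccessful trial step), and the aggregate plane $m_k^*(\cdot,x)$; all other planes may be removed. *)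

theory Defs
  imports "HOL-Analysis.Analysis"
begin

definition locally_lipschitz :: "(real^'n \<Rightarrow> real) \<Rightarrow> bool" where
  "locally_lipschitz f \<longleftrightarrow> (\<forall>x. \<exists>e>0. \<exists>L. L-lipschitz_on (ball x e) f)"

definition convex_subdifferential :: "(real^'n \<Rightarrow> real) \<Rightarrow> real^'n \<Rightarrow> (real^'n) set" where
  "convex_subdifferential h y = {g. \<forall>u. h y + g \<bullet> (u - y) \<le> h u}"

definition clarke_directional_derivative ::
    "(real^'n \<Rightarrow> real) \<Rightarrow> real^'n \<Rightarrow> real^'n \<Rightarrow> ereal" where
  "clarke_directional_derivative f x d =
     Limsup (nhds x \<times>\<^sub>F at_right (0::real)) (\<lambda>(u, t). ereal ((f (u + t *\<^sub>R d) - f u) / t))"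

definition clarke_subdifferential :: "(real^'n \<Rightarrow> real) \<Rightarrow> real^'n \<Rightarrow> (real^'n) set" where
  "clarke_subdifferential f x = {g. \<forall>d. ereal (g \<bullet> d) \<le> clarke_directional_derivative f x d}"

definition normal_cone :: "(real^'n) set \<Rightarrow> real^'n \<Rightarrow> (real^'n) set" where
  "normal_cone C y = {v. y \<in> C \<and> (\<forall>u\<in>C. v \<bullet> (u - y) \<le> 0)}"

text \<open>An arbitrary norm on the space, used to measure the trust region; it need not be the
  Euclidean norm. Nonnegativity follows from the three conditions.\<close>

definition is_norm :: "(real^'n \<Rightarrow> real) \<Rightarrow> bool" where
  "is_norm nrm \<longleftrightarrow> (\<forall>u. nrm u = 0 \<longleftrightarrow> u = 0) \<and>
     (\<forall>c u. nrm (c *\<^sub>R u) = \<bar>c\<bar> * nrm u) \<and> (\<forall>u v. nrm (u + v) \<le> nrm u + nrm v)"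

definition positive_definite :: "real^'n^'n \<Rightarrow> bool" where
  "positive_definite Q \<longleftrightarrow> transpose Q = Q \<and> (\<forall>u. u \<noteq> 0 \<longrightarrow> 0 < u \<bullet> (Q *v u))"

text \<open>Models are curried with the argument order \<open>\<phi> y x\<close> of \<open>\<phi>(y, x)\<close>: the second
  argument is the point at which the model is built.\<close>

definition strict_first_order_model ::
    "(real^'n \<Rightarrow> real) \<Rightarrow> (real^'n \<Rightarrow> real^'n \<Rightarrow> real) \<Rightarrow> bool" where
  "strict_first_order_model f \<phi> \<longleftrightarrow>
     (\<forall>x. convex_on UNIV (\<lambda>u. \<phi> u x) \<and> \<phi> x x = f x \<and>
          convex_subdifferential (\<lambda>u. \<phi> u x) x \<subseteq> clarke_subdifferential f x) \<and>
     (\<forall>x xs ys. xs \<longlonglongrightarrow> x \<longrightarrow> ys \<longlonglongrightarrow> x \<longrightarrow>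
        (\<exists>\<epsilon>. (\<forall>k. 0 < \<epsilon> k) \<and> \<epsilon> \<longlonglongrightarrow> 0 \<and>
             (\<forall>k. f (ys k) \<le> \<phi> (ys k) (xs k) + \<epsilon> k * norm (ys k - xs k)))) \<and>
     (\<forall>x y xs ys. xs \<longlonglongrightarrow> x \<longrightarrow> ys \<longlonglongrightarrow> y \<longrightarrow>
        limsup (\<lambda>k. ereal (\<phi> (ys k) (xs k))) \<le> ereal (\<phi> y x))"

definition cutting_planes ::
    "(real^'n \<Rightarrow> real^'n \<Rightarrow> real) \<Rightarrow> real^'n \<Rightarrow> real^'n \<Rightarrow> (real^'n \<Rightarrow> real) set" where
  "cutting_planes \<phi> x z =
     {m. \<exists>g \<in> convex_subdifferential (\<lambda>u. \<phi> u x) z. m = (\<lambda>u. \<phi> z x + g \<bullet> (u - z))}"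

abbreviation exactness_planes ::
    "(real^'n \<Rightarrow> real^'n \<Rightarrow> real) \<Rightarrow> real^'n \<Rightarrow> (real^'n \<Rightarrow> real) set" where
  "exactness_planes \<phi> x \<equiv> cutting_planes \<phi> x x"

text \<open>A first-order working model is represented by the finite set \<open>P\<close> of affine functions of
  which it is the maximum, so that the number of its planes is \<open>card P\<close>.\<close>

definition working_planes ::
    "(real^'n \<Rightarrow> real^'n \<Rightarrow> real) \<Rightarrow> real^'n \<Rightarrow> (real^'n \<Rightarrow> real) set \<Rightarrow> bool" where
  "working_planes \<phi> x P \<longleftrightarrow> finite P \<and>
     (\<forall>m\<in>P. (\<exists>a b. m = (\<lambda>u. a \<bullet> u + b)) \<and> (\<forall>u. m u \<le> \<phi> u x)) \<and>
     P \<inter> exactness_planes \<phi> x \<noteq> {}"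

definition first_order_model :: "(real^'n \<Rightarrow> real) set \<Rightarrow> real^'n \<Rightarrow> real" where
  "first_order_model P u = Max ((\<lambda>m. m u) ` P)"

definition second_order_model ::
    "real^'n^'n \<Rightarrow> real^'n \<Rightarrow> (real^'n \<Rightarrow> real) set \<Rightarrow> real^'n \<Rightarrow> real" where
  "second_order_model Q x P u = first_order_model P u + (u - x) \<bullet> (Q *v (u - x)) / 2"

definition trust_region :: "(real^'n \<Rightarrow> real) \<Rightarrow> real^'n \<Rightarrow> real \<Rightarrow> (real^'n) set" where
  "trust_region nrm x R = {u. nrm (u - x) \<le> R}"

definition tangent_solution ::
    "(real^'n \<Rightarrow> real) \<Rightarrow> real^'n \<Rightarrow> real^'n^'n \<Rightarrow> (real^'n \<Rightarrow> real) set \<Rightarrow> real \<Rightarrow> real^'n \<Rightarrow> bool" where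
  "tangent_solution nrm x Q P R y \<longleftrightarrow>
     is_arg_min (second_order_model Q x P) (\<lambda>u. u \<in> trust_region nrm x R) y"

definition trial_step ::
    "(real^'n \<Rightarrow> real) \<Rightarrow> (real^'n \<Rightarrow> real) \<Rightarrow> real^'n \<Rightarrow> real^'n^'n \<Rightarrow> real \<Rightarrow> real \<Rightarrow>
     (real^'n \<Rightarrow> real) set \<Rightarrow> real^'n \<Rightarrow> real^'n \<Rightarrow> bool" where
  "trial_step f nrm x Q \<theta> M P y z \<longleftrightarrow>
     nrm (z - x) \<le> M * nrm (y - x) \<and>
     f x - second_order_model Q x P z \<ge> \<theta> * (f x - second_order_model Q x P y)"

definition acceptance_ratio ::
    "(real^'n \<Rightarrow> real) \<Rightarrow> real^'n \<Rightarrow> real^'n^'n \<Rightarrow> (real^'n \<Rightarrow> real) set \<Rightarrow> real^'n \<Rightarrow> real" where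
  "acceptance_ratio f x Q P s = (f x - f s) / (f x - second_order_model Q x P s)"

text \<open>The secondary test quotient: \<open>P\<close> is the current working model and \<open>P'\<close> its update.\<close>

definition secondary_ratio ::
    "(real^'n \<Rightarrow> real) \<Rightarrow> real^'n \<Rightarrow> real^'n^'n \<Rightarrow> (real^'n \<Rightarrow> real) set \<Rightarrow>
     (real^'n \<Rightarrow> real) set \<Rightarrow> real^'n \<Rightarrow> real" where
  "secondary_ratio f x Q P P' s =
     (f x - first_order_model P' s) / (f x - second_order_model Q x P s)"

definition aggregate_planes ::
    "(real^'n \<Rightarrow> real) \<Rightarrow> real^'n \<Rightarrow> real^'n^'n \<Rightarrow> (real^'n \<Rightarrow> real) set \<Rightarrow> real \<Rightarrow> real^'n \<Rightarrow>
     (real^'n \<Rightarrow> real) set" where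
  "aggregate_planes nrm x Q P R y =
     {m. \<exists>g \<in> convex_subdifferential (first_order_model P) y.
         \<exists>v \<in> normal_cone (trust_region nrm x R) y.
           g + Q *v (y - x) + v = 0 \<and> m = (\<lambda>u. first_order_model P y + g \<bullet> (u - y))}"

text \<open>The update of the working model under the aggregation rule, with at most \<open>N\<close> planes:
  \<open>P'\<close> may replace \<open>P\<close> after the solution \<open>y\<close> of the tangent program and the unsuccessful
  trial step \<open>s\<close>. An exactness plane is retained through \<^const>\<open>working_planes\<close>.\<close>

definition aggregated_update ::
    "(real^'n \<Rightarrow> real^'n \<Rightarrow> real) \<Rightarrow> (real^'n \<Rightarrow> real) \<Rightarrow> real^'n \<Rightarrow> real^'n^'n \<Rightarrow> nat \<Rightarrow>
     (real^'n \<Rightarrow> real) set \<Rightarrow> real \<Rightarrow> real^'n \<Rightarrow> real^'n \<Rightarrow> (real^'n \<Rightarrow> real) set \<Rightarrow> bool" where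
  "aggregated_update \<phi> nrm x Q N P R y s P' \<longleftrightarrow>
     working_planes \<phi> x P' \<and> card P' \<le> N \<and>
     P' \<inter> cutting_planes \<phi> x s \<noteq> {} \<and>
     P' \<inter> aggregate_planes nrm x Q P R y \<noteq> {}"

definition updated_radius :: "real \<Rightarrow> real \<Rightarrow> real \<Rightarrow> real" where
  "updated_radius \<gamma>' r R = (if r < \<gamma>' then R else R / 2)"

text \<open>One pass of the loop with fall-back in which no trial step is accepted, leading from
  working model \<open>P\<close> and radius \<open>R\<close> to \<open>P'\<close> and \<open>R'\<close>. The set \<open>T\<close> is the tentative update
  formed with \<open>z\<close>; it is dropped together with \<open>z\<close> when the method falls back on \<open>y\<close>.\<close>

definition null_pass ::
    "(real^'n \<Rightarrow> real) \<Rightarrow> (real^'n \<Rightarrow> real^'n \<Rightarrow> real) \<Rightarrow> (real^'n \<Rightarrow> real) \<Rightarrow> real^'n \<Rightarrow> real^'n^'n \<Rightarrow>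
     real \<Rightarrow> real \<Rightarrow> real \<Rightarrow> real \<Rightarrow> nat \<Rightarrow>
     (real^'n \<Rightarrow> real) set \<Rightarrow> real \<Rightarrow> real^'n \<Rightarrow> real^'n \<Rightarrow> (real^'n \<Rightarrow> real) set \<Rightarrow> real \<Rightarrow> bool" where
  "null_pass f \<phi> nrm x Q \<gamma> \<gamma>' \<theta> M N P R y z P' R' \<longleftrightarrow>
     tangent_solution nrm x Q P R y \<and>
     trial_step f nrm x Q \<theta> M P y z \<and>
     acceptance_ratio f x Q P z < \<gamma> \<and>
     (\<exists>T. aggregated_update \<phi> nrm x Q N P R y z T \<and>
        (if secondary_ratio f x Q P T z \<ge> \<gamma>'
         then P' = T \<and> R' = R / 2
         else acceptance_ratio f x Q P y < \<gamma> \<and>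
              aggregated_update \<phi> nrm x Q N P R y y P' \<and>
              R' = updated_radius \<gamma>' (secondary_ratio f x Q P P' y) R))"

definition inner_loop_turns_infinitely ::
    "(real^'n \<Rightarrow> real) \<Rightarrow> (real^'n \<Rightarrow> real^'n \<Rightarrow> real) \<Rightarrow> (real^'n \<Rightarrow> real) \<Rightarrow> real^'n \<Rightarrow> real^'n^'n \<Rightarrow>
     real \<Rightarrow> real \<Rightarrow> real \<Rightarrow> real \<Rightarrow> real \<Rightarrow> nat \<Rightarrow> bool" where
  "inner_loop_turns_infinitely f \<phi> nrm x Q \<gamma> \<gamma>' \<theta> M R1 N \<longleftrightarrow>
     (\<exists>P R y z.
        working_planes \<phi> x (P 1) \<and> card (P 1) \<le> N \<and> R 1 = R1 \<and>
        (\<forall>k\<ge>1::nat. null_pass f \<phi> nrm x Q \<gamma> \<gamma>' \<theta> M N (P k) (R k) (y k) (z k)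
                       (P (Suc k)) (R (Suc k))))"

end

theory Submission
  imports Defs
begin

text \<open>It suffices that \<open>x\<close> minimizes the convex function \<open>\<phi>(\<cdot>, x)\<close>: then \<open>0\<close> is a convex
  subgradient there, and these are Clarke subgradients of \<open>f\<close>. Everything is measured by the
  predicted decrease, the gap between \<open>f x\<close> and the minimal value of the tangent program. If
  \<open>\<phi>(\<cdot>, x)\<close> had a smaller value somewhere, then by convexity a step of length \<open>t\<close> towards that
  point would gain an amount of order \<open>t\<close>, against a quadratic term of order \<open>t\<^sup>2\<close>
  (\<open>convex_descent_beats_quadratic\<close>); as working models are minorants of \<open>\<phi>(\<cdot>, x)\<close>, the predicted
  decrease would be at least a multiple of a small radius. The two possible behaviours of the
  radius contradict this in different ways.

  If the radius is halved infinitely often, it tends to zero. A failed step that causes a halving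
  satisfies the secondary test with \<open>\<gamma>'\<close> and violates the acceptance test with \<open>\<gamma> < \<gamma>'\<close>, so at
  this step \<open>f\<close> exceeds \<open>\<phi>(\<cdot>, x)\<close> by a fixed fraction of the predicted decrease, hence by at least
  a fixed multiple of the radius. A strict model allows only an excess that is of smaller order than the
  length of the step (\<open>minimum_if_halved_infinitely_often\<close>).

  If the radius is eventually constant, every failed step is a fall-back step, that is, an exact
  solution \<open>y\<close> of the tangent program. The aggregate plane, together with the strong convexity
  due to \<open>Q\<close>, makes the minimal values increase by at least the squared \<open>Q\<close>-distance of
  consecutive solutions, up to the factor one half (\<open>aggregated_model_growth\<close>). These values are
  bounded by \<open>f x\<close>, so the distances vanish. The cutting plane at \<open>y\<close> and the failed secondary
  test then force the predicted decrease to shrink by the factor \<open>\<gamma>' < 1\<close> up to a vanishing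
  error, so it tends to zero (\<open>predicted_decrease_tendsto_zero\<close>), whereas descent would keep it
  away from zero.\<close>

section \<open>Norms, quadratic forms and subgradients\<close>

lemma continuous_positive_on_sphere_bound:
  fixes p :: "real^'n \<Rightarrow> real"
  assumes "continuous_on UNIV p" and "\<And>u. u \<noteq> 0 \<Longrightarrow> 0 < p u"
  obtains c where "0 < c" and "\<And>u. norm u = 1 \<Longrightarrow> c \<le> p u"
proof -
  have ne: "sphere (0::real^'n) 1 \<noteq> {}"
    by simp
  have "continuous_on (sphere 0 1) p"
    using assms(1) continuous_on_subset by blast
  then obtain w where w: "w \<in> sphere 0 1" "\<forall>u\<in>sphere 0 1. p w \<le> p u"
    using continuous_attains_inf[OF compact_sphere ne] by blast
  have "w \<noteq> 0"
    using w(1) by auto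
  then show thesis
    using that[of "p w"] assms(2) w by auto
qed

lemma is_norm_nonneg:
  assumes "is_norm nrm"
  shows "0 \<le> nrm u"
proof -
  have "nrm (-1 *\<^sub>R u) = nrm u" "nrm 0 = 0" "nrm (u + (-1) *\<^sub>R u) \<le> nrm u + nrm (-1 *\<^sub>R u)"
    using assms unfolding is_norm_def by (metis abs_minus abs_1 mult_1, blast, blast)
  then show ?thesis
    by simp
qed

lemma is_norm_dominates_norm:
  fixes nrm :: "real^'n \<Rightarrow> real"
  assumes "is_norm nrm"
  obtains c where "0 < c" and "\<And>u. norm u \<le> c * nrm u"
proof -
  have hom: "nrm (c *\<^sub>R u) = \<bar>c\<bar> * nrm u" and tri: "nrm (u + v) \<le> nrm u + nrm v"
    and zero: "nrm u = 0 \<longleftrightarrow> u = 0" for c u v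
    using assms unfolding is_norm_def by auto
  have "convex_on UNIV nrm"
  proof (rule convex_onI)
    fix t :: real and u v :: "real^'n"
    assume "0 < t" "t < 1"
    then show "nrm ((1 - t) *\<^sub>R u + t *\<^sub>R v) \<le> (1 - t) * nrm u + t * nrm v"
      using tri[of "(1 - t) *\<^sub>R u" "t *\<^sub>R v"] by (simp add: hom)
  qed simp
  then have "continuous_on UNIV nrm"
    by (rule convex_on_continuous[OF open_UNIV])
  moreover have "0 < nrm u" if "u \<noteq> 0" for u
    using is_norm_nonneg[OF assms, of u] zero[of u] that by linarith
  ultimately obtain c where c: "0 < c" "\<And>u. norm u = 1 \<Longrightarrow> c \<le> nrm u"
    using continuous_positive_on_sphere_bound by blast
  have "norm u \<le> inverse c * nrm u" for u
  proof (cases "u = 0")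
    case False
    then have "c \<le> nrm (inverse (norm u) *\<^sub>R u)"
      by (intro c(2)) simp
    then show ?thesis
      using False c(1) by (simp add: hom field_simps)
  next
    case True
    then show ?thesis
      using zero[of 0] by simp
  qed
  then show thesis
    using that[of "inverse c"] c(1) by simp
qed

lemma positive_definite_coercive:
  fixes Q :: "real^'n^'n"
  assumes "positive_definite Q"
  obtains l where "0 < l" and "\<And>u. l * (norm u)\<^sup>2 \<le> u \<bullet> (Q *v u)"
proof -
  have "continuous_on UNIV (\<lambda>u. u \<bullet> (Q *v u))"
    by (intro continuous_intros matrix_vector_mult_linear_continuous_on)
  moreover have "0 < u \<bullet> (Q *v u)" if "u \<noteq> 0" for u
    using assms that unfolding positive_definite_def by blast
  ultimately obtain l where l: "0 < l" "\<And>u. norm u = 1 \<Longrightarrow> l \<le> u \<bullet> (Q *v u)"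
    using continuous_positive_on_sphere_bound by blast
  have "l * (norm u)\<^sup>2 \<le> u \<bullet> (Q *v u)" for u
  proof (cases "u = 0")
    case False
    then have "l \<le> (inverse (norm u) *\<^sub>R u) \<bullet> (Q *v (inverse (norm u) *\<^sub>R u))"
      by (intro l(2)) simp
    then show ?thesis
      using False by (simp add: matrix_vector_mult_scaleR field_simps power2_eq_square)
  qed simp
  with l(1) that show thesis
    by blast
qed

lemma positive_definite_nonneg:
  assumes "positive_definite Q"
  shows "0 \<le> u \<bullet> (Q *v u)"
  using assms unfolding positive_definite_def by (cases "u = 0") (auto intro: less_imp_le)

lemma symmetric_form_add:
  fixes Q :: "real^'n^'n"
  assumes "transpose Q = Q"
  shows "(a + b) \<bullet> (Q *v (a + b)) = a \<bullet> (Q *v a) + 2 * ((Q *v a) \<bullet> b) + b \<bullet> (Q *v b)"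
proof -
  have "a \<bullet> (Q *v b) = (Q *v a) \<bullet> b"
    by (metis assms dot_lmul_matrix transpose_matrix_vector)
  then show ?thesis
    by (simp add: matrix_vector_right_distrib inner_add_left inner_add_right inner_commute)
qed

lemma convex_subgradients_bounded:
  fixes h :: "real^'n \<Rightarrow> real"
  assumes "convex_on UNIV h" and "bounded S"
  obtains C where "0 \<le> C"
    and "\<And>w g. w \<in> S \<Longrightarrow> g \<in> convex_subdifferential h w \<Longrightarrow> norm g \<le> C"
proof -
  obtain r where r: "\<And>w. w \<in> S \<Longrightarrow> norm w \<le> r"
    using assms(2) unfolding bounded_iff by blast
  have "continuous_on UNIV h"
    by (rule convex_on_continuous[OF open_UNIV assms(1)])
  then have "bounded (h ` cball 0 (r + 1))"
    by (intro compact_imp_bounded compact_continuous_image compact_cball)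
      (rule continuous_on_subset, auto)
  then obtain B where B: "\<And>w. norm w \<le> r + 1 \<Longrightarrow> \<bar>h w\<bar> \<le> B"
    unfolding bounded_iff by force
  have bound: "norm g \<le> 2 * \<bar>B\<bar>" if "w \<in> S" and g: "g \<in> convex_subdifferential h w" for w g
  proof (cases "g = 0")
    case False
    \<comment> \<open>A unit step along \<open>g\<close> raises the affine minorant by the norm of \<open>g\<close>.\<close>
    define u where "u = w + inverse (norm g) *\<^sub>R g"
    have "norm u \<le> r + 1"
      unfolding u_def using False r[OF that(1)]
      by (intro order_trans[OF norm_triangle_ineq]) simp
    moreover have "h w + norm g \<le> h u"
    proof -
      have "g \<bullet> (u - w) = norm g"
        using False by (simp add: u_def power2_norm_eq_inner[symmetric] power2_eq_square)
      then show ?thesis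
        using g unfolding convex_subdifferential_def by (metis (lifting) mem_Collect_eq)
    qed
    moreover have "norm w \<le> r + 1"
      using r[OF that(1)] by simp
    ultimately show ?thesis
      using B[of u] B[of w] by linarith
  qed simp
  then show thesis
    using that[of "2 * \<bar>B\<bar>"] by simp
qed

section \<open>Working models\<close>

lemma plane_le_first_order_model:
  assumes "working_planes \<phi> x P" and "m \<in> P"
  shows "m u \<le> first_order_model P u"
  using assms unfolding working_planes_def first_order_model_def by simp

lemma first_order_model_le:
  assumes "working_planes \<phi> x P"
  shows "first_order_model P u \<le> \<phi> u x"
  using assms unfolding working_planes_def first_order_model_def by (subst Max_le_iff) auto

lemma first_order_model_at_cut:
  assumes "working_planes \<phi> x P" and "P \<inter> cutting_planes \<phi> x s \<noteq> {}"
  shows "first_order_model P s = \<phi> s x"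
proof (rule antisym)
  obtain g where "(\<lambda>u. \<phi> s x + g \<bullet> (u - s)) \<in> P"
    using assms(2) unfolding cutting_planes_def by auto
  from plane_le_first_order_model[OF assms(1) this, of s]
  show "\<phi> s x \<le> first_order_model P s"
    by simp
qed (rule first_order_model_le[OF assms(1)])

lemma second_order_model_at_center:
  assumes "working_planes \<phi> x P"
  shows "second_order_model Q x P x = \<phi> x x"
  using first_order_model_at_cut[OF assms, of x] assms
  by (simp add: second_order_model_def working_planes_def)

lemma second_order_model_le:
  assumes "working_planes \<phi> x P"
  shows "second_order_model Q x P u \<le> \<phi> u x + (u - x) \<bullet> (Q *v (u - x)) / 2"
  using first_order_model_le[OF assms, of u] by (simp add: second_order_model_def)

lemma tangent_solution_le:
  assumes "tangent_solution nrm x Q P R y" and "nrm (u - x) \<le> R"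
  shows "second_order_model Q x P y \<le> second_order_model Q x P u"
  using assms unfolding tangent_solution_def is_arg_min_def trust_region_def
  by (auto simp: not_less)

text \<open>The aggregate plane remembers the whole tangent program through its minimum: the
  optimality condition turns the linear part of the quadratic expansion at \<open>y\<close> into the negative
  of a normal vector, so that this part is nonnegative on the trust region.\<close>

lemma aggregated_model_growth:
  assumes "transpose Q = Q" and "aggregated_update \<phi> nrm x Q N P R y s P'"
    and "u \<in> trust_region nrm x R"
  shows "second_order_model Q x P y + (u - y) \<bullet> (Q *v (u - y)) / 2 \<le> second_order_model Q x P' u"
proof -
  obtain g v where gv: "v \<in> normal_cone (trust_region nrm x R) y" "g + Q *v (y - x) + v = 0"
    and plane: "(\<lambda>u. first_order_model P y + g \<bullet> (u - y)) \<in> P'"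
    using assms(2) unfolding aggregated_update_def aggregate_planes_def by blast
  have "first_order_model P y + g \<bullet> (u - y) \<le> first_order_model P' u"
    using plane_le_first_order_model[OF _ plane] assms(2) unfolding aggregated_update_def by blast
  moreover have "v \<bullet> (u - y) \<le> 0"
    using gv(1) assms(3) unfolding normal_cone_def by blast
  moreover have "g \<bullet> (u - y) + (Q *v (y - x)) \<bullet> (u - y) + v \<bullet> (u - y) = 0"
    using gv(2) by (metis inner_add_left inner_zero_left)
  ultimately show ?thesis
    using symmetric_form_add[OF assms(1), of "y - x" "u - y"]
    unfolding second_order_model_def by (simp add: add_divide_distrib)
qed

text \<open>The quadratic term cannot hide descent: along a segment a decrease of the convex function
  is of first order, the quadratic term of second order.\<close>

lemma convex_descent_beats_quadratic:
  fixes h :: "real^'n \<Rightarrow> real"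
  assumes "convex_on UNIV h" and "h u < h x"
  obtains t0 where "0 < t0"
    and "\<And>t. 0 < t \<Longrightarrow> t \<le> t0 \<Longrightarrow>
      h (x + t *\<^sub>R (u - x)) + (t *\<^sub>R (u - x)) \<bullet> (Q *v (t *\<^sub>R (u - x))) / 2
        \<le> h x - t * (h x - h u) / 2"
proof -
  define q where "q = (u - x) \<bullet> (Q *v (u - x))"
  define t0 where "t0 = min 1 ((h x - h u) / (\<bar>q\<bar> + 1))"
  have "0 < t0"
    using assms(2) by (simp add: t0_def)
  moreover have "h (x + t *\<^sub>R (u - x)) + (t *\<^sub>R (u - x)) \<bullet> (Q *v (t *\<^sub>R (u - x))) / 2
      \<le> h x - t * (h x - h u) / 2" if t: "0 < t" "t \<le> t0" for t
  proof -
    have "(1 - t) *\<^sub>R x + t *\<^sub>R u = x + t *\<^sub>R (u - x)"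
      by (simp add: algebra_simps)
    moreover have "h ((1 - t) *\<^sub>R x + t *\<^sub>R u) \<le> (1 - t) * h x + t * h u"
      using t by (intro convex_onD[OF assms(1)]) (auto simp: t0_def)
    ultimately have chord: "h (x + t *\<^sub>R (u - x)) \<le> h x - t * (h x - h u)"
      by (simp add: algebra_simps)
    have "t * q \<le> h x - h u"
    proof -
      have "t * q \<le> t * (\<bar>q\<bar> + 1)"
        using t by (intro mult_left_mono) auto
      also have "\<dots> \<le> (h x - h u) / (\<bar>q\<bar> + 1) * (\<bar>q\<bar> + 1)"
        using t by (intro mult_right_mono) (auto simp: t0_def)
      finally show ?thesis
        by simp
    qed
    then have "t * (t * q) \<le> t * (h x - h u)"
      using t by (intro mult_left_mono) auto
    moreover have "(t *\<^sub>R (u - x)) \<bullet> (Q *v (t *\<^sub>R (u - x))) = t * (t * q)"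
      by (simp add: q_def matrix_vector_mult_scaleR)
    ultimately show ?thesis
      using chord by linarith
  qed
  ultimately show thesis
    using that by blast
qed

section \<open>Infinite runs without an accepted step\<close>

text \<open>In an endless run every pass ends with one decisive unsuccessful step \<open>s k\<close>: the trial step
  \<open>z\<close> when the radius was halved because of it, and the fall-back \<open>y\<close> otherwise. The tests and
  updates that determine the next model and radius refer to this step, while \<open>y k\<close> enters through
  the aggregate plane; a discarded \<open>z\<close> leaves no trace.\<close>

locale endless_null_steps =
  fixes f :: "real^'n \<Rightarrow> real" and \<phi> :: "real^'n \<Rightarrow> real^'n \<Rightarrow> real"
    and nrm :: "real^'n \<Rightarrow> real" and x :: "real^'n" and Q :: "real^'n^'n"
    and \<gamma> \<gamma>' \<theta> M :: real and N :: nat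
    and P :: "nat \<Rightarrow> (real^'n \<Rightarrow> real) set" and R :: "nat \<Rightarrow> real" and y s :: "nat \<Rightarrow> real^'n"
  assumes model: "strict_first_order_model f \<phi>"
    and nrm: "is_norm nrm"
    and constants: "0 < \<gamma>" "\<gamma> < \<gamma>'" "\<gamma>' < 1" "0 < \<theta>" "0 < M"
    and pd: "positive_definite Q"
    and R0: "0 < R 0"
    and working: "\<And>k. working_planes \<phi> x (P k)"
    and tangent: "\<And>k. tangent_solution nrm x Q (P k) (R k) (y k)"
    and trial: "\<And>k. trial_step f nrm x Q \<theta> M (P k) (y k) (s k)"
    and rejected: "\<And>k. acceptance_ratio f x Q (P k) (s k) < \<gamma>"
    and update: "\<And>k. aggregated_update \<phi> nrm x Q N (P k) (R k) (y k) (s k) (P (Suc k))"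
    and radius: "\<And>k.
      (\<gamma>' \<le> secondary_ratio f x Q (P k) (P (Suc k)) (s k) \<and> R (Suc k) = R k / 2) \<or>
      (s k = y k \<and> secondary_ratio f x Q (P k) (P (Suc k)) (s k) < \<gamma>' \<and> R (Suc k) = R k)"
begin

definition predicted_decrease :: "nat \<Rightarrow> real" where
  "predicted_decrease k = f x - second_order_model Q x (P k) (y k)"

lemma convex_model: "convex_on UNIV (\<lambda>u. \<phi> u x)"
  and model_at_center: "\<phi> x x = f x"
  using model unfolding strict_first_order_model_def by blast+

lemma radius_pos: "0 < R k"
proof (induction k)
  case (Suc k)
  then show ?case
    using radius[of k] by auto
qed (rule R0)

lemma radius_decreasing: "decseq R"
proof (rule decseq_SucI)
  fix k
  show "R (Suc k) \<le> R k"
    using radius[of k] radius_pos[of k] by auto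
qed

lemma y_in_region: "nrm (y k - x) \<le> R k"
  using tangent[of k] unfolding tangent_solution_def is_arg_min_def trust_region_def by auto

lemma predicted_decrease_ge:
  assumes "nrm (u - x) \<le> R k"
  shows "f x - (\<phi> u x + (u - x) \<bullet> (Q *v (u - x)) / 2) \<le> predicted_decrease k"
  using tangent_solution_le[OF tangent assms] second_order_model_le[OF working, of Q k u]
  unfolding predicted_decrease_def by linarith

lemma predicted_decrease_nonneg: "0 \<le> predicted_decrease k"
proof -
  have "nrm (x - x) = 0"
    using nrm unfolding is_norm_def by simp
  then have "nrm (x - x) \<le> R k"
    using radius_pos[of k] by simp
  then show ?thesis
    using predicted_decrease_ge[of x k] by (simp add: model_at_center)
qed

lemma model_at_failed_step: "first_order_model (P (Suc k)) (s k) = \<phi> (s k) x"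
proof (rule first_order_model_at_cut[OF working])
  show "P (Suc k) \<inter> cutting_planes \<phi> x (s k) \<noteq> {}"
    using update[of k] unfolding aggregated_update_def by simp
qed

section \<open>Radius tending to zero\<close>

text \<open>The failed steps converge to \<open>x\<close>, so strictness of the model bounds the excess of \<open>f\<close> over
  \<open>\<phi>(\<cdot>, x)\<close> there by arbitrarily small multiples of the radius. A halving with positive predicted
  decrease requires an excess of at least a fixed fraction of it, and descent of \<open>\<phi>(\<cdot>, x)\<close> would
  make the predicted decrease comparable to the radius.\<close>

lemma minimum_if_halved_infinitely_often:
  assumes halved: "\<exists>\<^sub>\<infinity>k. \<gamma>' \<le> secondary_ratio f x Q (P k) (P (Suc k)) (s k) \<and> R (Suc k) = R k / 2"
  shows "f x \<le> \<phi> u x"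
proof (rule ccontr)
  assume "\<not> f x \<le> \<phi> u x"
  then have descent: "\<phi> u x < \<phi> x x"
    by (simp add: model_at_center)
  have lim_R: "R \<longlonglongrightarrow> 0"
  proof -
    obtain L where L: "R \<longlonglongrightarrow> L" "\<And>k. L \<le> R k"
    proof (rule decseq_convergent[OF radius_decreasing])
      show "\<forall>k. 0 \<le> R k"
        using radius_pos less_imp_le by blast
    qed blast
    have "L \<le> 0"
    proof (rule ccontr)
      assume "\<not> L \<le> 0"
      then have "\<forall>\<^sub>F k in sequentially. R k < 2 * L"
        using order_tendstoD(2)[OF L(1), of "2 * L"] by simp
      then obtain m where "\<And>k. m \<le> k \<Longrightarrow> R k < 2 * L"
        unfolding eventually_sequentially by blast
      then obtain k where "R k < 2 * L" "R (Suc k) = R k / 2"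
        using halved unfolding INFM_nat_le by blast
      then show False
        using L(2)[of "Suc k"] by simp
    qed
    moreover have "0 \<le> L"
      by (rule LIMSEQ_le_const[OF L(1)]) (use radius_pos less_imp_le in blast)
    ultimately show ?thesis
      using L(1) by simp
  qed
  obtain C where C: "0 < C" "\<And>w. norm w \<le> C * nrm w"
    using is_norm_dominates_norm[OF nrm] by blast
  have near: "norm (s k - x) \<le> C * M * R k" for k
  proof -
    have "nrm (s k - x) \<le> M * nrm (y k - x)"
      using trial[of k] unfolding trial_step_def by blast
    also have "\<dots> \<le> M * R k"
      using y_in_region constants by (intro mult_left_mono) auto
    finally have "C * nrm (s k - x) \<le> C * (M * R k)"
      using C(1) by (intro mult_left_mono) auto
    then show ?thesis
      using C(2)[of "s k - x"] by simp
  qed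
  have "(\<lambda>k. C * M * R k) \<longlonglongrightarrow> 0"
    using tendsto_mult_right_zero[OF lim_R] by blast
  then have "(\<lambda>k. s k - x) \<longlonglongrightarrow> 0"
    by (rule Lim_null_comparison[rotated]) (use near in auto)
  then have "s \<longlonglongrightarrow> x"
    using LIM_zero_iff by blast
  then obtain \<epsilon> where eps: "\<epsilon> \<longlonglongrightarrow> 0" "\<And>k. 0 < \<epsilon> k"
      "\<And>k. f (s k) \<le> \<phi> (s k) x + \<epsilon> k * norm (s k - x)"
    using model tendsto_const[of x sequentially] unfolding strict_first_order_model_def
    by meson
  obtain t0 where t0: "0 < t0" "\<And>t. 0 < t \<Longrightarrow> t \<le> t0 \<Longrightarrow>
      \<phi> (x + t *\<^sub>R (u - x)) x + (t *\<^sub>R (u - x)) \<bullet> (Q *v (t *\<^sub>R (u - x))) / 2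
        \<le> \<phi> x x - t * (\<phi> x x - \<phi> u x) / 2"
    using convex_descent_beats_quadratic[OF convex_model descent] by blast
  define d where "d = nrm (u - x)"
  have "u \<noteq> x"
    using descent by auto
  then have d: "0 < d"
    using nrm is_norm_nonneg[OF nrm, of "u - x"] unfolding is_norm_def d_def
    by (metis less_eq_real_def right_minus_eq)
  define c where "c = (\<phi> x x - \<phi> u x) / (2 * d)"
  have c: "0 < c"
    using d descent by (simp add: c_def)
  \<comment> \<open>For \<open>\<epsilon> k\<close> below this threshold the estimates at the end close the contradiction; the
    radius, being of the same order on both sides, cancels.\<close>
  have small: "(\<gamma>' - \<gamma>) * \<theta> * c / (C * M) > 0"
    using constants c C(1) by simp
  have "\<forall>\<^sub>F k in sequentially. R k < t0 * d \<and> \<epsilon> k < (\<gamma>' - \<gamma>) * \<theta> * c / (C * M)"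
    using order_tendstoD(2)[OF lim_R] order_tendstoD(2)[OF eps(1) small] t0(1) d
    by (intro eventually_conj) auto
  then obtain m where "\<And>k. m \<le> k \<Longrightarrow>
      R k < t0 * d \<and> \<epsilon> k < (\<gamma>' - \<gamma>) * \<theta> * c / (C * M)"
    unfolding eventually_sequentially by blast
  then obtain k where k: "R k < t0 * d" "\<epsilon> k < (\<gamma>' - \<gamma>) * \<theta> * c / (C * M)"
      "\<gamma>' \<le> secondary_ratio f x Q (P k) (P (Suc k)) (s k)"
    using halved unfolding INFM_nat_le by blast
  \<comment> \<open>The point of the ray from \<open>x\<close> through \<open>u\<close> on the boundary of the trust region.\<close>
  have predicted: "c * R k \<le> predicted_decrease k"
  proof -
    define t where "t = R k / d"
    have t: "0 < t" "t \<le> t0"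
      using k(1) radius_pos[of k] d by (auto simp: t_def field_simps)
    have "nrm (t *\<^sub>R (u - x)) = R k"
      using nrm d radius_pos[of k] unfolding is_norm_def t_def by (simp add: d_def[symmetric])
    then have "f x - (\<phi> (x + t *\<^sub>R (u - x)) x
        + (t *\<^sub>R (u - x)) \<bullet> (Q *v (t *\<^sub>R (u - x))) / 2) \<le> predicted_decrease k"
      using predicted_decrease_ge[of "x + t *\<^sub>R (u - x)" k] by simp
    then have "t * (\<phi> x x - \<phi> u x) / 2 \<le> predicted_decrease k"
      using t0(2)[OF t] by (simp add: model_at_center)
    then show ?thesis
      by (simp add: c_def t_def field_simps)
  qed
  define D where "D = f x - second_order_model Q x (P k) (s k)"
  have "\<theta> * predicted_decrease k \<le> D"
    using trial[of k] unfolding trial_step_def D_def predicted_decrease_def by simp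
  moreover have "\<theta> * (c * R k) \<le> \<theta> * predicted_decrease k"
    using predicted constants by (intro mult_left_mono) auto
  ultimately have D_ge: "\<theta> * (c * R k) \<le> D"
    by simp
  then have D: "0 < D"
    using constants c radius_pos[of k] by (smt (verit) mult_pos_pos)
  have "f x - f (s k) < \<gamma> * D"
    using rejected[of k] D unfolding acceptance_ratio_def D_def[symmetric]
    by (simp add: pos_divide_less_eq)
  moreover have "\<gamma>' * D \<le> f x - \<phi> (s k) x"
    using k(3) D unfolding secondary_ratio_def D_def[symmetric] model_at_failed_step
    by (simp add: pos_le_divide_eq)
  ultimately have "(\<gamma>' - \<gamma>) * D < \<epsilon> k * norm (s k - x)"
    using eps(3)[of k] by (simp add: algebra_simps)
  also have "\<dots> \<le> \<epsilon> k * (C * M * R k)"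
    using near eps(2) by (intro mult_left_mono) (auto intro: less_imp_le)
  also have "\<dots> \<le> (\<gamma>' - \<gamma>) * \<theta> * c / (C * M) * (C * M * R k)"
    using k(2) C(1) constants radius_pos[of k] by (intro mult_right_mono) auto
  also have "\<dots> = (\<gamma>' - \<gamma>) * (\<theta> * (c * R k))"
    using C(1) constants by simp
  also have "\<dots> \<le> (\<gamma>' - \<gamma>) * D"
    using D_ge constants by (intro mult_left_mono) auto
  finally show False
    by simp
qed

section \<open>Eventually constant radius\<close>

text \<open>With a constant radius the aggregate planes make the predicted decrease fall by the square
  of the distance of consecutive solutions, so this distance vanishes. The last cutting plane then
  lifts the next minimal value almost up to \<open>\<phi> (y k) x\<close>, and the failed secondary test turns this
  into a contraction by the factor \<open>\<gamma>'\<close>, so that the prediction tends to zero.\<close>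

lemma predicted_decrease_tendsto_zero:
  assumes const: "\<And>k. k \<ge> K \<Longrightarrow>
    s k = y k \<and> secondary_ratio f x Q (P k) (P (Suc k)) (s k) < \<gamma>' \<and> R (Suc k) = R k"
  shows "predicted_decrease \<longlonglongrightarrow> 0"
proof -
  define a where "a k = predicted_decrease (k + K)" for k
  define \<Delta> where "\<Delta> k = y (Suc k + K) - y (k + K)" for k
  have R_le: "R (k + K) \<le> R K" for k
    using decseqD[OF radius_decreasing] by simp
  have decrease: "a (Suc k) + \<Delta> k \<bullet> (Q *v \<Delta> k) / 2 \<le> a k" for k
  proof -
    have "y (Suc k + K) \<in> trust_region nrm x (R (k + K))"
      using y_in_region[of "Suc k + K"] const[of "k + K"] by (simp add: trust_region_def)
    then show ?thesis
      using aggregated_model_growth[OF _ update[of "k + K"], of "y (Suc k + K)"] pd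
      unfolding positive_definite_def a_def predicted_decrease_def \<Delta>_def by simp
  qed
  then have mono: "a (Suc k) \<le> a k" for k
    using positive_definite_nonneg[OF pd, of "\<Delta> k"] by (smt (verit) divide_nonneg_pos)
  obtain \<alpha> where lim_a: "a \<longlonglongrightarrow> \<alpha>"
  proof (rule decseq_convergent)
    show "decseq a"
      using mono by (rule decseq_SucI)
    show "\<forall>k. 0 \<le> a k"
      by (simp add: a_def predicted_decrease_nonneg)
  qed
  have "0 \<le> \<alpha>"
    by (rule LIMSEQ_le_const[OF lim_a]) (simp add: a_def predicted_decrease_nonneg)
  have lim_Suc: "(\<lambda>k. a (Suc k)) \<longlonglongrightarrow> \<alpha>"
    using lim_a by (rule LIMSEQ_Suc)
  have lim_\<Delta>: "(\<lambda>k. norm (\<Delta> k)) \<longlonglongrightarrow> 0"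
  proof -
    obtain l where l: "0 < l" "\<And>w. l * (norm w)\<^sup>2 \<le> w \<bullet> (Q *v w)"
      using positive_definite_coercive[OF pd] by blast
    have bound: "(norm (\<Delta> k))\<^sup>2 \<le> 2 / l * (a k - a (Suc k))" for k
      using decrease[of k] l(2)[of "\<Delta> k"] l(1) by (simp add: field_simps)
    have "(\<lambda>k. 2 / l * (a k - a (Suc k))) \<longlonglongrightarrow> 2 / l * (\<alpha> - \<alpha>)"
      by (intro tendsto_intros lim_a lim_Suc)
    then have "(\<lambda>k. 2 / l * (a k - a (Suc k))) \<longlonglongrightarrow> 0"
      by simp
    then have "(\<lambda>k. (norm (\<Delta> k))\<^sup>2) \<longlonglongrightarrow> 0"
      by (rule Lim_null_comparison[rotated]) (intro always_eventually allI, use bound in simp)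
    then show ?thesis
      by simp
  qed
  obtain C where C: "0 \<le> C"
    "\<And>k g. g \<in> convex_subdifferential (\<lambda>u. \<phi> u x) (y (k + K)) \<Longrightarrow> norm g \<le> C"
  proof -
    obtain c where c: "0 < c" "\<And>w. norm w \<le> c * nrm w"
      using is_norm_dominates_norm[OF nrm] by blast
    have "dist x (y (k + K)) \<le> c * R K" for k
    proof -
      have "c * nrm (y (k + K) - x) \<le> c * R K"
        using y_in_region[of "k + K"] R_le[of k] c(1) by (intro mult_left_mono) auto
      then show ?thesis
        using c(2)[of "y (k + K) - x"] by (simp add: dist_norm norm_minus_commute)
    qed
    then have "y (k + K) \<in> cball x (c * R K)" for k
      by simp
    then show thesis
      using convex_subgradients_bounded[OF convex_model bounded_cball[of x "c * R K"]] that
      by metis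
  qed
  have contract: "a (Suc k) \<le> \<gamma>' * a k + C * norm (\<Delta> k)" for k
  proof (cases "a k = 0")
    \<comment> \<open>The secondary ratio is then a division by zero, so monotonicity takes its place.\<close>
    case True
    then have "a (Suc k) \<le> 0"
      using mono[of k] by simp
    also have "0 \<le> \<gamma>' * a k + C * norm (\<Delta> k)"
      using True C(1) by simp
    finally show ?thesis .
  next
    case False
    let ?j = "k + K"
    have j: "s ?j = y ?j" "secondary_ratio f x Q (P ?j) (P (Suc ?j)) (s ?j) < \<gamma>'"
      using const[of ?j] by auto
    have pos: "0 < a k"
      using False predicted_decrease_nonneg[of ?j] by (simp add: a_def)
    have "f x - \<phi> (y ?j) x < \<gamma>' * a k"
      using j pos model_at_failed_step[of ?j]
      unfolding secondary_ratio_def a_def predicted_decrease_def by (simp add: pos_divide_less_eq)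
    moreover obtain g where g: "g \<in> convex_subdifferential (\<lambda>u. \<phi> u x) (y ?j)"
        "(\<lambda>u. \<phi> (y ?j) x + g \<bullet> (u - y ?j)) \<in> P (Suc ?j)"
      using update[of ?j] j(1) unfolding aggregated_update_def cutting_planes_def by auto
    have "\<phi> (y ?j) x + g \<bullet> \<Delta> k \<le> first_order_model (P (Suc ?j)) (y (Suc ?j))"
      using plane_le_first_order_model[OF working g(2)] unfolding \<Delta>_def by simp
    moreover have "\<bar>g \<bullet> \<Delta> k\<bar> \<le> C * norm (\<Delta> k)"
      using Cauchy_Schwarz_ineq2[of g "\<Delta> k"] mult_right_mono[OF C(2)[OF g(1)] norm_ge_zero[of "\<Delta> k"]]
      by linarith
    moreover have "first_order_model (P (Suc ?j)) (y (Suc ?j)) \<le> f x - a (Suc k)"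
      using positive_definite_nonneg[OF pd, of "y (Suc ?j) - x"]
      unfolding a_def predicted_decrease_def second_order_model_def by simp
    ultimately show ?thesis
      by linarith
  qed
  have "(\<lambda>k. \<gamma>' * a k + C * norm (\<Delta> k)) \<longlonglongrightarrow> \<gamma>' * \<alpha> + C * 0"
    by (intro tendsto_intros lim_a lim_\<Delta>)
  then have "\<alpha> \<le> \<gamma>' * \<alpha>"
    using LIMSEQ_le[OF lim_Suc] contract by fastforce
  then have "(1 - \<gamma>') * \<alpha> \<le> 0"
    by (simp add: algebra_simps)
  with \<open>0 \<le> \<alpha>\<close> constants have "\<alpha> = 0"
    by (smt (verit) mult_pos_pos)
  then show ?thesis
    using lim_a unfolding a_def by (simp add: LIMSEQ_offset)
qed

lemma minimum_if_radius_constant: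
  assumes const: "\<And>k. k \<ge> K \<Longrightarrow>
    s k = y k \<and> secondary_ratio f x Q (P k) (P (Suc k)) (s k) < \<gamma>' \<and> R (Suc k) = R k"
  shows "f x \<le> \<phi> u x"
proof (rule ccontr)
  assume "\<not> f x \<le> \<phi> u x"
  then have descent: "\<phi> u x < \<phi> x x"
    by (simp add: model_at_center)
  obtain t0 where t0: "0 < t0" "\<And>t. 0 < t \<Longrightarrow> t \<le> t0 \<Longrightarrow>
      \<phi> (x + t *\<^sub>R (u - x)) x + (t *\<^sub>R (u - x)) \<bullet> (Q *v (t *\<^sub>R (u - x))) / 2
        \<le> \<phi> x x - t * (\<phi> x x - \<phi> u x) / 2"
    using convex_descent_beats_quadratic[OF convex_model descent] by blast
  \<comment> \<open>Small enough to stay in the fixed trust region; the added \<open>1\<close> only keeps the denominator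
    positive.\<close>
  define t where "t = min t0 (R K / (nrm (u - x) + 1))"
  have n: "0 \<le> nrm (u - x)"
    by (rule is_norm_nonneg[OF nrm])
  then have t: "0 < t" "t \<le> t0"
    using t0(1) radius_pos[of K] by (auto simp: t_def)
  have "t * (nrm (u - x) + 1) \<le> R K"
    using n by (simp add: t_def pos_le_divide_eq[symmetric])
  then have inside: "nrm (t *\<^sub>R (u - x)) \<le> R K"
    using nrm t(1) unfolding is_norm_def by (simp add: distrib_left)
  have "t * (\<phi> x x - \<phi> u x) / 2 \<le> predicted_decrease k" if "k \<ge> K" for k
  proof -
    have "R k = R K"
      using that by (induction k rule: dec_induct) (use const in simp_all)
    then show ?thesis
      using inside predicted_decrease_ge[of "x + t *\<^sub>R (u - x)" k] t0(2)[OF t]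
      by (simp add: model_at_center)
  qed
  then have "t * (\<phi> x x - \<phi> u x) / 2 \<le> 0"
    using LIMSEQ_le_const[OF predicted_decrease_tendsto_zero[OF const]] by blast
  moreover have "0 < t * (\<phi> x x - \<phi> u x)"
    using t(1) descent by simp
  ultimately show False
    by simp
qed

section \<open>Stationarity of the centre\<close>

lemma zero_in_clarke_subdifferential: "0 \<in> clarke_subdifferential f x"
proof -
  have "f x \<le> \<phi> u x" for u
  proof (cases "\<exists>\<^sub>\<infinity>k. \<gamma>' \<le> secondary_ratio f x Q (P k) (P (Suc k)) (s k) \<and> R (Suc k) = R k / 2")
    case True
    then show ?thesis
      by (rule minimum_if_halved_infinitely_often)
  next
    case False
    then obtain K where "\<And>k. k \<ge> K \<Longrightarrow>
        \<not> (\<gamma>' \<le> secondary_ratio f x Q (P k) (P (Suc k)) (s k) \<and> R (Suc k) = R k / 2)"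
      unfolding INFM_nat_le by blast
    then show ?thesis
      using minimum_if_radius_constant[of K] radius by blast
  qed
  then have "0 \<in> convex_subdifferential (\<lambda>u. \<phi> u x) x"
    by (simp add: convex_subdifferential_def model_at_center)
  then show ?thesis
    using model unfolding strict_first_order_model_def by blast
qed

end

text \<open>The fall-back point \<open>y\<close> is itself a legitimate trial step, which allows both outcomes of a
  pass to be described by the same conditions. It passes the test with \<open>\<theta> < 1\<close> because the
  exactness plane makes the predicted decrease nonnegative.\<close>

lemma null_pass_decisive_step:
  assumes pass: "null_pass f \<phi> nrm x Q \<gamma> \<gamma>' \<theta> M N P R y z P' R'"
    and "is_norm nrm" "\<theta> < 1" "1 \<le> M" "0 < R"
    and "working_planes \<phi> x P" and "\<phi> x x = f x"
  shows "\<exists>s. trial_step f nrm x Q \<theta> M P y s \<and> acceptance_ratio f x Q P s < \<gamma> \<and>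
    aggregated_update \<phi> nrm x Q N P R y s P' \<and>
    (\<gamma>' \<le> secondary_ratio f x Q P P' s \<and> R' = R / 2 \<or>
     s = y \<and> secondary_ratio f x Q P P' s < \<gamma>' \<and> R' = R)"
proof -
  have "nrm (x - x) \<le> R"
    using assms unfolding is_norm_def by (metis diff_self less_imp_le)
  then have "second_order_model Q x P y \<le> f x"
    using pass tangent_solution_le second_order_model_at_center[OF assms(6)] assms(7)
    unfolding null_pass_def by metis
  then have "\<theta> * (f x - second_order_model Q x P y) \<le> 1 * (f x - second_order_model Q x P y)"
    using assms(3) by (intro mult_right_mono) auto
  moreover have "1 * nrm (y - x) \<le> M * nrm (y - x)"
    using assms(4) is_norm_nonneg[OF assms(2)] by (intro mult_right_mono)
  ultimately have y_trial: "trial_step f nrm x Q \<theta> M P y y"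
    by (simp add: trial_step_def)
  show ?thesis
    using pass y_trial unfolding null_pass_def updated_radius_def
    by (auto split: if_splits simp: not_less)
qed

theorem lemma4:
  fixes f :: "real^'n \<Rightarrow> real" and \<phi> :: "real^'n \<Rightarrow> real^'n \<Rightarrow> real"
    and nrm :: "real^'n \<Rightarrow> real" and x :: "real^'n" and Q :: "real^'n^'n"
    and \<gamma> \<gamma>' \<theta> M R1 :: real and N :: nat
  assumes "locally_lipschitz f"
    and "strict_first_order_model f \<phi>"
    and "is_norm nrm"
    and "0 < \<gamma>" "\<gamma> < \<gamma>'" "\<gamma>' < 1"
    and "0 < \<theta>" "\<theta> < 1"
    and "M \<ge> 1"
    and "R1 > 0"
    and "positive_definite Q"
    and "N \<ge> 3"
    and "inner_loop_turns_infinitely f \<phi> nrm x Q \<gamma> \<gamma>' \<theta> M R1 N"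
  shows "0 \<in> clarke_subdifferential f x"
proof -
  obtain P R y z where start: "working_planes \<phi> x (P 1)" "R 1 = R1"
    and pass: "\<And>k. k \<ge> 1 \<Longrightarrow> null_pass f \<phi> nrm x Q \<gamma> \<gamma>' \<theta> M N (P k) (R k) (y k) (z k)
      (P (Suc k)) (R (Suc k))"
    using assms(13) unfolding inner_loop_turns_infinitely_def by metis
  have center: "\<phi> x x = f x"
    using assms(2) unfolding strict_first_order_model_def by blast
  note decisive = null_pass_decisive_step[OF pass assms(3,8,9) _ _ center]
  have valid: "working_planes \<phi> x (P (Suc k)) \<and> 0 < R (Suc k)" for k
  proof (induction k)
    case 0
    then show ?case
      using start assms(10) by simp
  next
    case (Suc k)
    then show ?case
      using decisive[of "Suc k"] unfolding aggregated_update_def by auto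
  qed
  have "\<forall>k. \<exists>s. trial_step f nrm x Q \<theta> M (P (Suc k)) (y (Suc k)) s \<and>
      acceptance_ratio f x Q (P (Suc k)) s < \<gamma> \<and>
      aggregated_update \<phi> nrm x Q N (P (Suc k)) (R (Suc k)) (y (Suc k)) s (P (Suc (Suc k))) \<and>
      (\<gamma>' \<le> secondary_ratio f x Q (P (Suc k)) (P (Suc (Suc k))) s \<and>
         R (Suc (Suc k)) = R (Suc k) / 2 \<or>
       s = y (Suc k) \<and> secondary_ratio f x Q (P (Suc k)) (P (Suc (Suc k))) s < \<gamma>' \<and>
         R (Suc (Suc k)) = R (Suc k))"
    using decisive valid by simp
  then obtain s where s: "\<And>k. trial_step f nrm x Q \<theta> M (P (Suc k)) (y (Suc k)) (s k) \<and>
      acceptance_ratio f x Q (P (Suc k)) (s k) < \<gamma> \<and>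
      aggregated_update \<phi> nrm x Q N (P (Suc k)) (R (Suc k)) (y (Suc k)) (s k) (P (Suc (Suc k))) \<and>
      (\<gamma>' \<le> secondary_ratio f x Q (P (Suc k)) (P (Suc (Suc k))) (s k) \<and>
         R (Suc (Suc k)) = R (Suc k) / 2 \<or>
       s k = y (Suc k) \<and> secondary_ratio f x Q (P (Suc k)) (P (Suc (Suc k))) (s k) < \<gamma>' \<and>
         R (Suc (Suc k)) = R (Suc k))"
    by metis
  \<comment> \<open>The loop counts from \<open>1\<close>; what happens at counter \<open>0\<close> is unspecified.\<close>
  interpret endless_null_steps f \<phi> nrm x Q \<gamma> \<gamma>' \<theta> M N
    "\<lambda>k. P (Suc k)" "\<lambda>k. R (Suc k)" "\<lambda>k. y (Suc k)" s
  proof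
    show "tangent_solution nrm x Q (P (Suc k)) (R (Suc k)) (y (Suc k))" for k
      using pass[of "Suc k"] unfolding null_pass_def by simp
  qed (use assms valid s in auto)
  show ?thesis
    by (rule zero_in_clarke_subdifferential)
qed

end
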